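(* Let $0<p<1$. Let $(d_k)_{k=0}^\infty$ be the unique bounded sequence of real numbers satisfying $$d_0=\frac{1-p}{p},\qquad d_k=\frac{pk\,d_{k-1}+(1-p)k\,d_{k+1}}{k+p}\quad (k\ge 1).$$ Then $(d_k)_{k=1}^\infty$ defines a probability distribution, i.e. $$\sum_{k=1}^\infty d_k=1.$$ *)

theory Defs
  imports Complex_Main
begin

definition bounded_solution :: "real \<Rightarrow> (nat \<Rightarrow> real) \<Rightarrow> bool" where
  "bounded_solution p d \<longleftrightarrow>
     Bseq d \<and>
     d 0 = (1 - p) / p \<and>
     (\<forall>k\<ge>1. d k = (p * real k * d (k - 1) + (1 - p) * real k * d (k + 1)) / (real k + p))"

text \<open>The value at index 0 is not part of the distribution: only the terms
  with index at least 1 are required to be nonnegative and to sum to 1.\<close>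

definition prob_distribution_from_1 :: "(nat \<Rightarrow> real) \<Rightarrow> bool" where
  "prob_distribution_from_1 d \<longleftrightarrow> (\<forall>k\<ge>1. 0 \<le> d k) \<and> (\<lambda>k. d (k + 1)) sums 1"

end

theory Submission
  imports Defs "HOL-Analysis.Harmonic_Numbers"
begin

text \<open>Write \<open>q = 1 - p\<close>. In terms of the increments of \<open>d\<close> the recurrence reads
  \<open>q k (d\<^bsub>k+1\<^esub> - d\<^bsub>k\<^esub>) = p k (d\<^bsub>k\<^esub> - d\<^bsub>k-1\<^esub>) + p d\<^bsub>k\<^esub>\<close>, so a solution that is nonnegative and
  increases once increases forever, with increments at least of harmonic size; this gives uniqueness.
  For existence take the solution \<open>e\<close> with initial values \<open>0, 1\<close> and an increasing solution \<open>b\<close> with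
  the right value at 0. By the sign of the Casoratian, \<open>b/e\<close> decreases to some \<open>L\<close>, and
  \<open>d = b - L e\<close> is the limit of the solutions \<open>b - (b\<^bsub>N\<^esub>/e\<^bsub>N\<^esub>) e\<close>, which vanish at \<open>N\<close> and hence are
  nonincreasing up to \<open>N\<close>. Thus \<open>d\<close> is nonnegative and nonincreasing. Summation by parts gives
  \<open>q (d\<^bsub>1\<^esub> + \<dots> + d\<^bsub>n\<^esub>) = q + q n d\<^bsub>n+1\<^esub> - p (n+1) d\<^bsub>n\<^esub>\<close>. As \<open>d\<close> is nonincreasing, the recurrence makes
  \<open>(k+1) d\<^bsub>k\<^esub>\<close> nonincreasing too, so it converges; the partial sums then converge as well, and since
  the harmonic series diverges, the limit of \<open>(k+1) d\<^bsub>k\<^esub>\<close> must be 0.\<close>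

text \<open>The index is shifted to \<open>Suc k\<close> to avoid truncated subtraction, and the
  denominator \<open>k + p\<close> is cleared so that signs of consecutive increments can be
  compared.\<close>

definition recurrence :: "real \<Rightarrow> (nat \<Rightarrow> real) \<Rightarrow> bool" where
  "recurrence p f \<longleftrightarrow> (\<forall>k. (1 - p) * real (Suc k) * (f (Suc (Suc k)) - f (Suc k)) =
     p * real (Suc k) * (f (Suc k) - f k) + p * f (Suc k))"

fun initial_value_solution :: "real \<Rightarrow> real \<Rightarrow> real \<Rightarrow> nat \<Rightarrow> real" where
  "initial_value_solution p a b 0 = a"
| "initial_value_solution p a b (Suc 0) = b"
| "initial_value_solution p a b (Suc (Suc k)) = initial_value_solution p a b (Suc k) +
     (p * real (Suc k) * (initial_value_solution p a b (Suc k) - initial_value_solution p a b k)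
      + p * initial_value_solution p a b (Suc k)) / ((1 - p) * real (Suc k))"

lemma recurrence_initial_value_solution:
  assumes "p < 1"
  shows "recurrence p (initial_value_solution p a b)"
  using assms by (simp add: recurrence_def del: of_nat_Suc)

lemma recurrence_diff_scaled:
  assumes "recurrence p f" "recurrence p g"
  shows "recurrence p (\<lambda>k. f k - c * g k)"
  unfolding recurrence_def
proof
  fix k
  let ?D = "\<lambda>h. (1 - p) * real (Suc k) * (h (Suc (Suc k)) - h (Suc k))"
  let ?R = "\<lambda>h. p * real (Suc k) * (h (Suc k) - h k) + p * h (Suc k)"
  have "?D (\<lambda>k. f k - c * g k) = ?D f - c * ?D g"
    by (simp add: algebra_simps del: of_nat_Suc)
  also have "\<dots> = ?R f - c * ?R g"
    using assms unfolding recurrence_def by simp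
  also have "\<dots> = ?R (\<lambda>k. f k - c * g k)"
    by (simp add: algebra_simps del: of_nat_Suc)
  finally show "?D (\<lambda>k. f k - c * g k) = ?R (\<lambda>k. f k - c * g k)" .
qed

lemma bounded_solution_iff:
  assumes "0 < p" "p < 1"
  shows "bounded_solution p d \<longleftrightarrow> Bseq d \<and> d 0 = (1 - p) / p \<and> recurrence p d"
proof -
  have "d k = (p * real k * d (k - 1) + (1 - p) * real k * d (k + 1)) / (real k + p) \<longleftrightarrow>
     (1 - p) * real k * (d (k + 1) - d k) = p * real k * (d k - d (k - 1)) + p * d k" for k
  proof -
    have "real k + p \<noteq> 0" using assms by linarith
    then show ?thesis by (auto simp: field_simps)
  qed
  then have "(\<forall>k\<ge>1. d k = (p * real k * d (k - 1) + (1 - p) * real k * d (k + 1)) / (real k + p))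
      \<longleftrightarrow> (\<forall>k\<ge>1. (1 - p) * real k * (d (k + 1) - d k) = p * real k * (d k - d (k - 1)) + p * d k)"
    by (simp only:)
  also have "\<dots> \<longleftrightarrow> recurrence p d"
  proof -
    have "(\<forall>k\<ge>1. P k) \<longleftrightarrow> (\<forall>k. P (Suc k))" for P :: "nat \<Rightarrow> bool"
      by (metis One_nat_def Suc_le_D Suc_le_mono le0)
    then show ?thesis by (simp only: recurrence_def diff_Suc_1 Suc_eq_plus1[symmetric])
  qed
  finally show ?thesis by (simp add: bounded_solution_def)
qed

lemma recurrence_increasing:
  assumes "0 < p" "p < 1" "recurrence p f" "0 \<le> f m" "f m < f (Suc m)" "m \<le> j"
  shows "0 \<le> f j \<and> f j < f (Suc j)"
  using \<open>m \<le> j\<close>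
proof (induction j rule: dec_induct)
  case (step j)
  have "0 < p * real (Suc j) * (f (Suc j) - f j) + p * f (Suc j)"
    using step assms(1) by (intro add_pos_pos mult_pos_pos) auto
  also have "\<dots> = (1 - p) * real (Suc j) * (f (Suc (Suc j)) - f (Suc j))"
    using assms(3) unfolding recurrence_def by metis
  finally have "0 < f (Suc (Suc j)) - f (Suc j)"
    by (rule zero_less_mult_pos) (use assms(2) in simp)
  then show ?case using step by simp
qed (use assms in auto)

lemma recurrence_strict_mono:
  assumes "0 < p" "p < 1" "recurrence p f" "0 \<le> f m" "f m < f (Suc m)" "m \<le> i" "i < j"
  shows "f i < f j"
  using \<open>i < j\<close>
proof (induction j)
  case (Suc j)
  have "f j < f (Suc j)"
    using recurrence_increasing[OF assms(1-5), of j] Suc.prems \<open>m \<le> i\<close> by simp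
  then show ?case using Suc by (cases "i = j") auto
qed simp

lemma not_summable_scaled_harmonic:
  assumes "(c::real) \<noteq> 0"
  shows "\<not> summable (\<lambda>k. c / real (Suc k))"
  using not_summable_harmonic[where 'a = real] assms summable_cmult_iff[of c "\<lambda>k. inverse (real (Suc k))"]
    summable_Suc_iff[of "\<lambda>k. inverse (real k)"]
  by (simp add: divide_inverse del: of_nat_Suc)

text \<open>Dropping the nonnegative increment term from the right side of the recurrence bounds the
  next increment below by a multiple of \<open>1 / Suc k\<close>, whereas a bounded increasing
  sequence has summable increments.\<close>

lemma recurrence_unbounded:
  assumes p: "0 < p" "p < 1" and rec: "recurrence p f" and f: "f 0 = 0" "0 < f 1"
  shows "\<not> Bseq f"
proof
  assume "Bseq f"
  have mono: "f i < f j" if "i < j" for i j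
    using recurrence_strict_mono[OF p rec, of 0 i j] f that by simp
  then have "incseq f" by (metis le_less mono_def)
  then obtain l where "f \<longlonglongrightarrow> l"
    using \<open>Bseq f\<close> Bseq_monoseq_convergent convergent_def incseq_imp_monoseq by blast
  then have "(\<lambda>k. f (Suc k)) \<longlonglongrightarrow> l" by (rule LIMSEQ_Suc)
  then have "summable (\<lambda>k. f (Suc (Suc k)) - f (Suc k))"
    by (rule telescope_summable)
  then have "summable (\<lambda>k. (p * f 1 / (1 - p)) / real (Suc k))"
  proof (rule summable_comparison_test'[where N = 0])
    fix k
    have "p * f 1 \<le> p * f (Suc k)"
      using p mono[of 1 "Suc k"] by (cases "k = 0") auto
    also have "\<dots> \<le> p * real (Suc k) * (f (Suc k) - f k) + p * f (Suc k)"
      using p mono[of k "Suc k"] by simp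
    also have "\<dots> = (1 - p) * real (Suc k) * (f (Suc (Suc k)) - f (Suc k))"
      using rec unfolding recurrence_def by metis
    finally have "p * f 1 / (1 - p) / real (Suc k) \<le> f (Suc (Suc k)) - f (Suc k)"
      using p by (simp add: divide_le_eq mult_ac)
    then show "norm (p * f 1 / (1 - p) / real (Suc k)) \<le> f (Suc (Suc k)) - f (Suc k)"
      using p f by simp
  qed
  then show False
    using not_summable_scaled_harmonic[of "p * f 1 / (1 - p)"] p f by simp
qed

lemma bounded_recurrence_unique:
  assumes p: "0 < p" "p < 1" and f: "recurrence p f" "Bseq f" and g: "recurrence p g" "Bseq g"
    and "f 0 = g 0"
  shows "f = g"
proof -
  \<comment> \<open>Unboundedness needs a difference that is positive at 1, so one inequality is
    shown for arbitrary \<open>u\<close>, \<open>v\<close> and then used in both orders.\<close>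
  have le: "u 1 \<le> v 1" if "recurrence p u" "Bseq u" "recurrence p v" "Bseq v" "u 0 = v 0" for u v
  proof (rule ccontr)
    assume "\<not> u 1 \<le> v 1"
    moreover have "recurrence p (\<lambda>k. u k - v k)"
      using recurrence_diff_scaled[OF \<open>recurrence p u\<close> \<open>recurrence p v\<close>, of 1] by simp
    ultimately have "\<not> Bseq (\<lambda>k. u k - v k)"
      using recurrence_unbounded[OF p, of "\<lambda>k. u k - v k"] \<open>u 0 = v 0\<close> by simp
    moreover obtain A B where "\<And>k. norm (u k) \<le> A" "\<And>k. norm (v k) \<le> B"
      using \<open>Bseq u\<close> \<open>Bseq v\<close> unfolding Bseq_def by blast
    then have "norm (u k - v k) \<le> A + B" for k
      by (meson add_mono norm_triangle_ineq4 order_trans)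
    then have "Bseq (\<lambda>k. u k - v k)" by (rule BseqI')
    ultimately show False by simp
  qed
  have "f 1 = g 1"
    using le[OF f g] le[OF g f] \<open>f 0 = g 0\<close> by simp
  have "f k = g k \<and> f (Suc k) = g (Suc k)" for k
  proof (induction k)
    case (Suc k)
    have "(1 - p) * real (Suc k) * (f (Suc (Suc k)) - f (Suc k)) =
        (1 - p) * real (Suc k) * (g (Suc (Suc k)) - g (Suc k))"
      using f(1) g(1) Suc unfolding recurrence_def by metis
    then show ?case using p Suc by (simp del: of_nat_Suc)
  qed (use \<open>f 0 = g 0\<close> \<open>f 1 = g 1\<close> in simp)
  then show ?thesis by blast
qed

text \<open>When the two recurrences are combined, the terms in \<open>f (Suc k) * g (Suc k)\<close>
  cancel, so each step multiplies the Casoratian by \<open>p / (1 - p) > 0\<close>.\<close>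

lemma casoratian_pos:
  assumes p: "0 < p" "p < 1" and f: "recurrence p f" and g: "recurrence p g"
    and "0 < f 0 * g 1 - f 1 * g 0"
  shows "0 < f k * g (Suc k) - f (Suc k) * g k"
proof (induction k)
  case (Suc k)
  let ?D = "\<lambda>h. (1 - p) * real (Suc k) * (h (Suc (Suc k)) - h (Suc k))"
  let ?R = "\<lambda>h. p * real (Suc k) * (h (Suc k) - h k) + p * h (Suc k)"
  have "(1 - p) * real (Suc k) * (f (Suc k) * g (Suc (Suc k)) - f (Suc (Suc k)) * g (Suc k)) =
      f (Suc k) * ?D g - g (Suc k) * ?D f"
    by (simp add: algebra_simps del: of_nat_Suc)
  also have "\<dots> = f (Suc k) * ?R g - g (Suc k) * ?R f"
    using f g unfolding recurrence_def by simp
  also have "\<dots> = p * real (Suc k) * (f k * g (Suc k) - f (Suc k) * g k)"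
    by (simp add: algebra_simps del: of_nat_Suc)
  finally have "(1 - p) * real (Suc k) * (f (Suc k) * g (Suc (Suc k)) - f (Suc (Suc k)) * g (Suc k)) =
      p * real (Suc k) * (f k * g (Suc k) - f (Suc k) * g k)" .
  moreover have "0 < p * real (Suc k) * (f k * g (Suc k) - f (Suc k) * g k)"
    using Suc p by (intro mult_pos_pos) auto
  ultimately have "0 < (1 - p) * real (Suc k) * (f (Suc k) * g (Suc (Suc k)) - f (Suc (Suc k)) * g (Suc k))"
    by linarith
  then show ?case
    by (rule zero_less_mult_pos) (use p in simp)
qed (use assms in simp)

lemma decreasing_solution_exists:
  assumes p: "0 < p" "p < 1" and "0 < a"
  obtains d where "recurrence p d" "d 0 = a" "\<And>k. 0 \<le> d k" "\<And>k. d (Suc k) \<le> d k"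
proof -
  define e where "e = initial_value_solution p 0 1"
  \<comment> \<open>Any second value above \<open>a\<close> makes \<open>b\<close> increase and stay
    nonnegative; the initial Casoratian of \<open>b\<close> and \<open>e\<close> is
    \<open>a > 0\<close>.\<close>
  define b where "b = initial_value_solution p a (2 * a)"
  have rec: "recurrence p e" "recurrence p b"
    using recurrence_initial_value_solution p by (auto simp: e_def b_def)
  have init: "e 0 = 0" "e 1 = 1" "b 0 = a" "b 1 = 2 * a"
    by (auto simp: e_def b_def)
  have e_pos: "0 < e k" if "0 < k" for k
    using recurrence_strict_mono[OF p rec(1), of 0 0 k] init that by simp
  have b_nonneg: "0 \<le> b k" for k
    using recurrence_increasing[OF p rec(2), of 0 k] init \<open>0 < a\<close> by simp
  \<comment> \<open>The shift avoids dividing by \<open>e 0 = 0\<close>.\<close>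
  define r where "r k = b (Suc k) / e (Suc k)" for k
  have "r (Suc k) \<le> r k" for k
    using casoratian_pos[OF p rec(2,1), of "Suc k"] init \<open>0 < a\<close> e_pos[of "Suc k"] e_pos[of "Suc (Suc k)"]
    by (simp add: r_def field_simps)
  then have "decseq r" by (simp add: decseq_Suc_iff)
  moreover have "0 \<le> r k" for k
    using e_pos[of "Suc k"] b_nonneg[of "Suc k"] by (simp add: r_def)
  ultimately obtain L where L: "r \<longlonglongrightarrow> L" "\<And>k. L \<le> r k"
    using decseq_convergent by metis
  have below: "0 \<le> b k - r N * e k" if "k \<le> Suc N" for k N
  proof (cases k)
    case (Suc m)
    then have "r N \<le> r m" using \<open>decseq r\<close> that by (simp add: decseq_def)
    then show ?thesis using e_pos[of k] Suc by (simp add: r_def field_simps)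
  qed (use \<open>0 < a\<close> init in simp)
  have vanish: "b (Suc N) - r N * e (Suc N) = 0" for N
    using e_pos[of "Suc N"] by (simp add: r_def)
  \<comment> \<open>An increase at \<open>k\<close> from a nonnegative value would persist up to
    \<open>Suc N\<close>, where the combination vanishes.\<close>
  have dec: "b (Suc k) - r N * e (Suc k) \<le> b k - r N * e k" if "k \<le> N" for k N
  proof (rule ccontr)
    assume "\<not> ?thesis"
    moreover have "recurrence p (\<lambda>k. b k - r N * e k)"
      by (rule recurrence_diff_scaled[OF rec(2,1)])
    ultimately have "b k - r N * e k < b (Suc N) - r N * e (Suc N)"
      using recurrence_strict_mono[OF p, of "\<lambda>k. b k - r N * e k" k k "Suc N"] below[of k N] that
      by simp
    then show False using vanish below[of k N] that by simp
  qed
  have lim: "(\<lambda>N. b k - r N * e k) \<longlonglongrightarrow> b k - L * e k" for k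
    by (intro tendsto_intros L)
  show thesis
  proof (rule that[of "\<lambda>k. b k - L * e k"])
    show "recurrence p (\<lambda>k. b k - L * e k)"
      by (rule recurrence_diff_scaled[OF rec(2,1)])
    show "b 0 - L * e 0 = a" using init by simp
    show "0 \<le> b k - L * e k" for k
      by (rule LIMSEQ_le_const[OF lim]) (use below in \<open>auto intro!: exI[of _ k]\<close>)
    show "b (Suc k) - L * e (Suc k) \<le> b k - L * e k" for k
      by (rule LIMSEQ_le[OF lim lim]) (use dec in blast)
  qed
qed

text \<open>The induction step is the recurrence itself. The value of \<open>d 0\<close> enters only
  at \<open>n = 0\<close>, where it makes the right side vanish; it thereby fixes the total
  mass.\<close>

lemma recurrence_partial_sum:
  assumes "0 < p" "recurrence p d" "d 0 = (1 - p) / p"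
  shows "(1 - p) * (\<Sum>k<n. d (Suc k)) =
    (1 - p) + (1 - p) * real n * d (Suc n) - p * real (Suc n) * d n"
proof (induction n)
  case (Suc n)
  have "(1 - p) * real (Suc n) * (d (Suc (Suc n)) - d (Suc n)) =
     p * real (Suc n) * (d (Suc n) - d n) + p * d (Suc n)"
    using assms(2) unfolding recurrence_def by blast
  then show ?case using Suc by (simp add: algebra_simps)
qed (use assms in simp)

lemma decreasing_solution_sums:
  assumes p: "0 < p" "p < 1" and rec: "recurrence p d" and d0: "d 0 = (1 - p) / p"
    and nonneg: "\<And>k. 0 \<le> d k" and dec: "\<And>k. d (Suc k) \<le> d k"
  shows "(\<lambda>k. d (Suc k)) sums 1"
proof -
  define x where "x k = real (Suc k) * d k" for k
  have "x (Suc k) \<le> x k" for k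
  proof -
    \<comment> \<open>The left side is exactly \<open>p * (x (Suc k) - x k)\<close>.\<close>
    have "p * real (Suc k) * (d (Suc k) - d k) + p * d (Suc k) =
        (1 - p) * real (Suc k) * (d (Suc (Suc k)) - d (Suc k))"
      using rec unfolding recurrence_def by metis
    also have "\<dots> \<le> 0"
      using p dec[of "Suc k"] by (intro mult_nonneg_nonpos) auto
    finally have "p * (x (Suc k) - x k) \<le> 0"
      by (simp add: x_def algebra_simps)
    then show ?thesis using p by (simp add: mult_le_0_iff)
  qed
  then have "decseq x" by (simp add: decseq_Suc_iff)
  moreover have "0 \<le> x k" for k using nonneg by (simp add: x_def)
  ultimately obtain c where c: "x \<longlonglongrightarrow> c" "\<And>k. c \<le> x k"
    using decseq_convergent by metis
  have "0 \<le> c" using c(1) \<open>\<And>k. 0 \<le> x k\<close> LIMSEQ_le_const by blast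
  \<comment> \<open>Written in terms of \<open>x\<close>, both boundary terms of the partial sum
    converge.\<close>
  have partial: "(\<Sum>k<n. d (Suc k)) = 1 + real n / real (Suc (Suc n)) * x (Suc n) - p / (1 - p) * x n"
    for n
  proof -
    have "real n / real (Suc (Suc n)) * x (Suc n) = real n * d (Suc n)"
      by (simp add: x_def del: of_nat_Suc)
    moreover have "(1 - p) * (p / (1 - p) * x n) = p * real (Suc n) * d n"
      using p by (simp add: x_def del: of_nat_Suc)
    ultimately have "(1 - p) * (1 + real n / real (Suc (Suc n)) * x (Suc n) - p / (1 - p) * x n) =
        (1 - p) * (\<Sum>k<n. d (Suc k))"
      using recurrence_partial_sum[OF p(1) rec d0, of n]
      by (simp only: distrib_left right_diff_distrib mult_1_right mult.assoc)
    then show ?thesis using p by simp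
  qed
  have "(\<lambda>n. real n / real (Suc (Suc n))) \<longlonglongrightarrow> 1"
  proof -
    have "(\<lambda>n. 1 - 2 * inverse (real (Suc (Suc n)))) \<longlonglongrightarrow> 1 - 2 * 0"
      by (intro tendsto_intros LIMSEQ_Suc[OF LIMSEQ_inverse_real_of_nat])
    moreover have "1 - 2 * inverse (real (Suc (Suc n))) = real n / real (Suc (Suc n))" for n
      by (simp add: field_simps)
    ultimately show ?thesis by simp
  qed
  then have "(\<lambda>n. 1 + real n / real (Suc (Suc n)) * x (Suc n) - p / (1 - p) * x n)
      \<longlonglongrightarrow> 1 + 1 * c - p / (1 - p) * c"
    by (intro tendsto_intros c LIMSEQ_Suc[OF c(1)])
  then have sums: "(\<lambda>k. d (Suc k)) sums (1 + 1 * c - p / (1 - p) * c)"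
    unfolding sums_def partial .
  then have "summable d" using sums_summable summable_Suc_iff by blast
  have "c = 0"
  proof (rule ccontr)
    assume "c \<noteq> 0"
    \<comment> \<open>Since \<open>x\<close> decreases to \<open>c\<close>, \<open>d\<close>
      dominates \<open>c\<close> times the harmonic terms.\<close>
    have "norm (c / real (Suc k)) \<le> d k" for k
      using c(2)[of k] \<open>0 \<le> c\<close> by (simp add: x_def divide_le_eq mult.commute)
    then have "summable (\<lambda>k. c / real (Suc k))"
      by (intro summable_comparison_test'[OF \<open>summable d\<close>])
    then show False using not_summable_scaled_harmonic \<open>c \<noteq> 0\<close> by blast
  qed
  then show ?thesis using sums by simp
qed

theorem lemma4p6:
  fixes p :: real
  assumes "0 < p" and "p < 1"
  shows "(\<exists>!d. bounded_solution p d) \<and>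
         (\<forall>d. bounded_solution p d \<longrightarrow> prob_distribution_from_1 d)"
proof -
  obtain d where d: "recurrence p d" "d 0 = (1 - p) / p" "\<And>k. 0 \<le> d k" "\<And>k. d (Suc k) \<le> d k"
    using decreasing_solution_exists[OF assms, of "(1 - p) / p"] assms by auto
  have "d k \<le> d 0" for k
    using d(4) decseq_Suc_iff[of d] by (simp add: decseq_def)
  then have "Bseq d" using d(3) by (intro BseqI'[of _ "d 0"]) simp
  then have "bounded_solution p d"
    using d bounded_solution_iff assms by blast
  \<comment> \<open>By uniqueness it suffices to check the distribution property for the constructed
    \<open>d\<close>.\<close>
  moreover have "f = d" if "bounded_solution p f" for f
    using bounded_recurrence_unique[OF assms, of f d] that \<open>Bseq d\<close> d bounded_solution_iff[OF assms]
    by simp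
  moreover have "prob_distribution_from_1 d"
    using d decreasing_solution_sums[OF assms d] by (simp add: prob_distribution_from_1_def)
  ultimately show ?thesis by metis
qed

end
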